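(* Suppose $\delta=1$, $r>0$, and let $C_0,\dots,C_r$ be subgroups of $G$ containing $Z$ such that $G$ is the free product of $C_0,\dots,C_r$ amalgamated along $Z$ and $C_i\cong\mathbb{F}_{q^2}^*$ for $i\ge1$. Let $1\le i,j\le r$ with $i\ne j$ and let $\psi_{ij}:C_i\to C_j$ be an isomorphism fixing $Z$ elementwise, $\psi_{ji}=\psi_{ij}^{-1}$. Then there is an automorphism $\psi^{i\leftrightarrow j}$ of $G$ with $\psi^{i\leftrightarrow j}(g)=\psi_{ij}(g)$ for $g\in C_i$, $\psi^{i\leftrightarrow j}(g)=\psi_{ji}(g)$ for $g\in C_j$, and $\psi^{i\leftrightarrow j}(g)=g$ for $g\in C_k$, $k\ne i,j$.
   Context: Let $\mathbb{F}_q$ be a finite field, $K$ an algebraic function field in one variable with constant field $\mathbb{F}_q$, $\infty$ a fixed place of $K$ of degree $\delta$, and $A$ the ring of elements of $K$ integral at every place other than $\infty$. Let $G=GL_2(A)$ and $Z=\{\lambda I_2:\lambda\in\mathbb{F}_q^*\}$ its centre. Let $\mathcal{T}$ be the Bruhat–Tits tree of $GL_2(K_\infty)$ ($K_\infty$ the completion of $K$ at $\infty$), on which $G$ acts; $r$ is the number of vertices $\tilde v$ of $G\backslash\mathcal{T}$ whose stabilizer $G_v$ (stabilizer of a lift, defined up to conjugacy) is isomorphic to $\mathbb{F}_{q^2}^*$. *)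

theory Defs
  imports "HOL-Analysis.Analysis" "HOL-Algebra.Algebra" "HOL-Algebra.Algebraic_Closure_Type"
begin

section \<open>Function fields and places\<close>

text \<open>The function field \<open>K\<close> is an arbitrary type \<open>'k\<close> of class \<open>field\<close>; the constant \<open>type_ring\<close>
  is that field seen as a ring record, so that the field theory of \<open>HOL-Algebra\<close> applies.\<close>

abbreviation type_ring :: "'k::field ring" where
  "type_ring \<equiv> ring_of_type_algebra"

text \<open>\<open>K\<close> is an algebraic function field in one variable whose full constant field is \<open>F\<close>: a finite
  extension of \<open>F(x)\<close> for some \<open>x\<close> transcendental over \<open>F\<close>, in which \<open>F\<close> is algebraically closed.\<close>

definition function_field :: "'k::field set \<Rightarrow> bool" where
  "function_field F \<longleftrightarrow>
     subfield F type_ring \<and>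
     (\<exists>x. ring.transcendental type_ring F x \<and>
          ring.finite_dimension type_ring (generate_field type_ring (insert x F)) UNIV) \<and>
     (\<forall>x. ring.algebraic type_ring F x \<longrightarrow> x \<in> F)"

text \<open>A place of \<open>K/F\<close> is represented by its valuation ring \<open>V\<close>, with \<open>F \<subseteq> V \<subset> K\<close>; the place as an
  ideal is then \<open>place_ideal V\<close>, the set of non-units of \<open>V\<close>.\<close>

definition is_place :: "'k::field set \<Rightarrow> 'k set \<Rightarrow> bool" where
  "is_place F V \<longleftrightarrow>
     subring V type_ring \<and> F \<subseteq> V \<and> V \<noteq> UNIV \<and> (\<forall>z. z \<in> V \<or> inverse z \<in> V)"

definition place_ideal :: "'k::field set \<Rightarrow> 'k set" where
  "place_ideal V = V - Units (type_ring\<lparr>carrier := V\<rparr>)"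

definition residue_ring_at :: "'k::field set \<Rightarrow> 'k set ring" where
  "residue_ring_at V = (type_ring\<lparr>carrier := V\<rparr>) Quot (place_ideal V)"

text \<open>The degree of a place is the dimension of its residue field over (the image of) \<open>F\<close>.\<close>

definition place_degree :: "'k::field set \<Rightarrow> 'k set \<Rightarrow> nat \<Rightarrow> bool" where
  "place_degree F V d \<longleftrightarrow>
     ring.dimension (residue_ring_at V) d
       ((\<lambda>a. place_ideal V +>\<^bsub>type_ring\<lparr>carrier := V\<rparr>\<^esub> a) ` F)
       (carrier (residue_ring_at V))"

definition integral_away_from :: "'k::field set \<Rightarrow> 'k set \<Rightarrow> 'k set" where
  "integral_away_from F Vinf = {x. \<forall>V. is_place F V \<and> V \<noteq> Vinf \<longrightarrow> x \<in> V}"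


section \<open>The group \<open>GL\<^sub>2(A)\<close> and its centre\<close>

definition mat2_monoid :: "'k::field set \<Rightarrow> ('k^2^2) monoid" where
  "mat2_monoid A = \<lparr>carrier = {M. \<forall>i j. M $ i $ j \<in> A}, monoid.mult = (**), one = mat 1\<rparr>"

definition GL2 :: "'k::field set \<Rightarrow> ('k^2^2) monoid" where
  "GL2 A = units_of (mat2_monoid A)"

definition scalars :: "'k::field set \<Rightarrow> ('k^2^2) set" where
  "scalars F = {mat c | c. c \<in> F \<and> c \<noteq> 0}"


section \<open>Completion and the vertices of the Bruhat--Tits tree\<close>

text \<open>\<open>\<iota>\<close> exhibits the type \<open>'c\<close> as the completion of \<open>K\<close> at the place with valuation ring \<open>V\<close>: a
  complete field whose metric comes from a non-archimedean absolute value \<open>dist x 0\<close>, containing \<open>K\<close>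
  as a dense subfield on which the absolute value has valuation ring \<open>V\<close>.
  Since \<open>V\<close> determines the absolute value on \<open>K\<close> up to equivalence, this fixes the completion up to
  unique isomorphism of topological fields over \<open>K\<close>.\<close>

definition is_completion :: "'k::field set \<Rightarrow> ('k \<Rightarrow> 'c::{field,complete_space}) \<Rightarrow> bool" where
  "is_completion V \<iota> \<longleftrightarrow>
     \<iota> \<in> ring_hom type_ring type_ring \<and>
     (\<forall>x y z::'c. dist (x + z) (y + z) = dist x y) \<and>
     (\<forall>x y::'c. dist (x * y) 0 = dist x 0 * dist y 0) \<and>
     (\<forall>x y z::'c. dist x z \<le> max (dist x y) (dist y z)) \<and>
     closure (range \<iota>) = UNIV \<and>
     (\<forall>x. x \<in> V \<longleftrightarrow> dist (\<iota> x) 0 \<le> 1)"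

text \<open>Lattices in \<open>K\<^sub>\<infinity>\<^sup>2\<close> are the finitely generated submodules over the valuation ring
  \<open>cball 0 1\<close> of \<open>K\<^sub>\<infinity>\<close> that span \<open>K\<^sub>\<infinity>\<^sup>2\<close>; vertices of the tree are their homothety classes.
  (The edges do not enter into the vertices of the quotient graph or their stabilizers.)\<close>

definition is_lattice :: "('c::{field,complete_space}^2) set \<Rightarrow> bool" where
  "is_lattice L \<longleftrightarrow>
     (\<exists>B. finite B \<and> L = {(\<Sum>b\<in>B. f b *s b) | f. \<forall>b\<in>B. f b \<in> cball 0 1}) \<and>
     vec.span L = UNIV"

definition homothety_class :: "('c::field^2) set \<Rightarrow> ('c^2) set set" where
  "homothety_class L = {((*s) c) ` L | c. c \<noteq> 0}"

definition tree_vertices :: "('c::{field,complete_space}^2) set set set" where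
  "tree_vertices = {homothety_class L | L. is_lattice L}"

definition tree_action ::
  "('k::field \<Rightarrow> 'c::field) \<Rightarrow> 'k^2^2 \<Rightarrow> ('c^2) set set \<Rightarrow> ('c^2) set set" where
  "tree_action \<iota> g \<Lambda> = (\<lambda>L. ((*v) (map_matrix \<iota> g)) ` L) ` \<Lambda>"

text \<open>The number of vertices of \<open>G\T\<close>, that is of \<open>G\<close>-orbits of vertices, whose stabilizer
  is isomorphic to a given group \<open>H\<close>. As usual for \<open>card\<close>, a positive value implies finiteness.\<close>

definition num_quotient_vertices ::
  "('k^2^2) monoid \<Rightarrow> ('k::field \<Rightarrow> 'c::{field,complete_space}) \<Rightarrow> 'h monoid \<Rightarrow> nat" where
  "num_quotient_vertices G \<iota> H =
     card {Group_Action.orbit G (tree_action \<iota>) v | v.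
             v \<in> tree_vertices \<and> G\<lparr>carrier := stabilizer G (tree_action \<iota>) v\<rparr> \<cong> H}"


section \<open>Amalgamated free products\<close>

text \<open>For subgroups \<open>C i\<close> (\<open>i \<in> I\<close>) of \<open>G\<close> containing a common subgroup \<open>Z\<close>, the free product of the
  \<open>C i\<close> amalgamated along \<open>Z\<close> is the monoid of words in the letters \<open>(i, g)\<close>, \<open>g \<in> C i\<close>, modulo the
  congruence generated by the multiplication and units of the factors (giving the free product)
  and by the identification of the copies of \<open>Z\<close>.\<close>

definition amalg_words :: "'i set \<Rightarrow> ('i \<Rightarrow> 'a set) \<Rightarrow> ('i \<times> 'a) list set" where
  "amalg_words I C = lists (Sigma I C)"

inductive amalg_cong ::
  "('a, 'b) monoid_scheme \<Rightarrow> 'i set \<Rightarrow> ('i \<Rightarrow> 'a set) \<Rightarrow> 'a set \<Rightarrow>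
   ('i \<times> 'a) list \<Rightarrow> ('i \<times> 'a) list \<Rightarrow> bool"
  for G (structure) and I C Z where
  mult: "\<lbrakk>i \<in> I; g \<in> C i; h \<in> C i\<rbrakk> \<Longrightarrow> amalg_cong G I C Z [(i, g), (i, h)] [(i, g \<otimes> h)]"
| unit: "i \<in> I \<Longrightarrow> amalg_cong G I C Z [(i, \<one>)] []"
| amalg: "\<lbrakk>i \<in> I; j \<in> I; z \<in> Z\<rbrakk> \<Longrightarrow> amalg_cong G I C Z [(i, z)] [(j, z)]"
| refl: "w \<in> amalg_words I C \<Longrightarrow> amalg_cong G I C Z w w"
| sym: "amalg_cong G I C Z u v \<Longrightarrow> amalg_cong G I C Z v u"
| trans: "\<lbrakk>amalg_cong G I C Z u v; amalg_cong G I C Z v w\<rbrakk> \<Longrightarrow> amalg_cong G I C Z u w"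
| append: "\<lbrakk>amalg_cong G I C Z u u'; amalg_cong G I C Z v v'\<rbrakk>
             \<Longrightarrow> amalg_cong G I C Z (u @ v) (u' @ v')"

definition word_value :: "('a, 'b) monoid_scheme \<Rightarrow> ('i \<times> 'a) list \<Rightarrow> 'a" where
  "word_value G w = foldr (\<lambda>(i, g) x. g \<otimes>\<^bsub>G\<^esub> x) w \<one>\<^bsub>G\<^esub>"

text \<open>\<open>G\<close> is the amalgamated free product of its subgroups \<open>C i\<close> along \<open>Z\<close>: the map from that product
  to \<open>G\<close> induced by the inclusions is surjective (first clause on \<open>word_value\<close>) and well-defined and
  injective (second clause).\<close>

definition is_amalgam ::
  "('a, 'b) monoid_scheme \<Rightarrow> 'i set \<Rightarrow> ('i \<Rightarrow> 'a set) \<Rightarrow> 'a set \<Rightarrow> bool" where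
  "is_amalgam G I C Z \<longleftrightarrow>
     subgroup Z G \<and> (\<forall>i\<in>I. subgroup (C i) G \<and> Z \<subseteq> C i) \<and>
     word_value G ` amalg_words I C = carrier G \<and>
     (\<forall>u\<in>amalg_words I C. \<forall>v\<in>amalg_words I C.
        word_value G u = word_value G v \<longleftrightarrow> amalg_cong G I C Z u v)"

end

theory Submission
  imports Defs
begin

text \<open>By the universal property of the amalgam, the homomorphisms \<open>\<psi>\<close> on \<open>C\<^sub>i\<close>, its inverse on
  \<open>C\<^sub>j\<close> and the identity on the other factors, which agree on \<open>Z\<close>, extend to an endomorphism of
  \<open>G\<close>. Its square is the identity on every factor, hence on \<open>G\<close>, so it is an automorphism.\<close>

section \<open>Words in the factors and their values in the group\<close>

lemma word_value_Nil: "word_value G [] = \<one>\<^bsub>G\<^esub>"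
  by (simp add: word_value_def)

lemma word_value_Cons: "word_value G ((k, g) # w) = g \<otimes>\<^bsub>G\<^esub> word_value G w"
  by (simp add: word_value_def)

lemma (in monoid) word_value_closed:
  "snd ` set w \<subseteq> carrier G \<Longrightarrow> word_value G w \<in> carrier G"
  by (induction w) (auto simp: word_value_Nil word_value_Cons)

lemma (in monoid) word_value_append:
  assumes "snd ` set u \<subseteq> carrier G" "snd ` set v \<subseteq> carrier G"
  shows "word_value G (u @ v) = word_value G u \<otimes> word_value G v"
  using assms
  by (induction u) (auto simp: word_value_Nil word_value_Cons word_value_closed m_assoc)

text \<open>Every rule keeps the letters inside the factors, because each \<open>C k\<close> is
  closed under multiplication, contains the unit and contains \<open>Z\<close>. It provides the
  membership of letters that the multiplicativity of \<open>word_value\<close> on concatenations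
  depends on.\<close>

lemma amalg_cong_in_words:
  assumes "\<And>k. k \<in> I \<Longrightarrow> subgroup (C k) G \<and> Z \<subseteq> C k" and "amalg_cong G I C Z u v"
  shows "u \<in> amalg_words I C \<and> v \<in> amalg_words I C"
  using assms(2)
proof induction
  case (mult k g h)
  then show ?case
    using assms(1)[of k] by (auto simp: amalg_words_def intro: subgroup.m_closed)
next
  case (unit k)
  then show ?case
    using assms(1)[of k] by (auto simp: amalg_words_def intro: subgroup.one_closed)
next
  case (amalg k l z)
  then show ?case
    using assms(1)[of k] assms(1)[of l] by (auto simp: amalg_words_def)
qed (auto simp: amalg_words_def)

section \<open>Universal property of the amalgam\<close>

definition map_word :: "('i \<Rightarrow> 'a \<Rightarrow> 'b) \<Rightarrow> ('i \<times> 'a) list \<Rightarrow> ('i \<times> 'b) list" where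
  "map_word f = map (\<lambda>(k, g). (k, f k g))"

lemma map_word_simps [simp]:
  "map_word f [] = []"
  "map_word f ((k, g) # w) = (k, f k g) # map_word f w"
  "map_word f (u @ v) = map_word f u @ map_word f v"
  by (simp_all add: map_word_def)

lemma set_map_word_subset:
  assumes "\<And>k. k \<in> I \<Longrightarrow> f k \<in> C k \<rightarrow> D" and "w \<in> amalg_words I C"
  shows "snd ` set (map_word f w) \<subseteq> D"
  using assms unfolding amalg_words_def map_word_def by fastforce

text \<open>This is what makes the induced map on the amalgam well defined. Each generating relation
  is respected for its own reason: products and units because every \<open>f k\<close> is a
  homomorphism, the identification of the copies of \<open>Z\<close> because of
  \<open>agree\<close>.\<close>

lemma amalg_cong_map_word_value:
  assumes "group H"
    and sub: "\<And>k. k \<in> I \<Longrightarrow> subgroup (C k) G \<and> Z \<subseteq> C k" and "group G"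
    and hom: "\<And>k. k \<in> I \<Longrightarrow> f k \<in> hom (G\<lparr>carrier := C k\<rparr>) H"
    and agree: "\<And>k l z. k \<in> I \<Longrightarrow> l \<in> I \<Longrightarrow> z \<in> Z \<Longrightarrow> f k z = f l z"
    and "amalg_cong G I C Z u v"
  shows "word_value H (map_word f u) = word_value H (map_word f v)"
  using assms(6)
proof induction
  interpret H: group H by fact
  have f_closed: "f k g \<in> carrier H" if "k \<in> I" "g \<in> C k" for k g
    using hom[OF that(1)] that(2) by (auto simp: hom_def)
  have letters: "snd ` set (map_word f w) \<subseteq> carrier H" if "w \<in> amalg_words I C" for w
    by (rule set_map_word_subset[OF _ that]) (auto intro: f_closed)
  {
    case (mult k g h)
    then show ?case
      using hom[of k] f_closed by (simp add: word_value_Cons word_value_Nil hom_def)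
  next
    case (unit k)
    then have "f k \<one>\<^bsub>G\<^esub> = \<one>\<^bsub>H\<^esub>"
      using hom_one[OF hom[OF unit] subgroup.subgroup_is_group[of "C k" G] \<open>group H\<close>]
        sub[of k] \<open>group G\<close> by auto
    then show ?case by (simp add: word_value_Cons word_value_Nil)
  next
    case (amalg k l z)
    then show ?case
      using agree[of k l z] by (simp add: word_value_Cons)
  next
    case (append u u' v v')
    then have "u \<in> amalg_words I C" "u' \<in> amalg_words I C"
      "v \<in> amalg_words I C" "v' \<in> amalg_words I C"
      using amalg_cong_in_words[where I = I and C = C and G = G, OF sub] by blast+
    with append.IH show ?case
      by (simp add: H.word_value_append letters)
  }
qed simp_all

text \<open>Existence half of the universal property: write an element of \<open>G\<close> as a
  word, apply \<open>f\<close> letter by letter and multiply out in \<open>H\<close>. The outcome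
  does not depend on the word, since words of equal value in \<open>G\<close> are congruent.\<close>

lemma amalg_hom_exists:
  assumes "group G" and "group H" and am: "is_amalgam G I C Z"
    and hom: "\<And>k. k \<in> I \<Longrightarrow> f k \<in> hom (G\<lparr>carrier := C k\<rparr>) H"
    and agree: "\<And>k l z. k \<in> I \<Longrightarrow> l \<in> I \<Longrightarrow> z \<in> Z \<Longrightarrow> f k z = f l z"
  obtains \<Phi> where "\<Phi> \<in> hom G H" and "\<And>k g. k \<in> I \<Longrightarrow> g \<in> C k \<Longrightarrow> \<Phi> g = f k g"
proof -
  interpret G: group G by fact
  interpret H: group H by fact
  have sub: "subgroup (C k) G \<and> Z \<subseteq> C k" if "k \<in> I" for k
    using am that unfolding is_amalgam_def by blast
  have surj: "word_value G ` amalg_words I C = carrier G"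
    using am unfolding is_amalgam_def by blast
  have f_closed: "f k \<in> C k \<rightarrow> carrier H" if "k \<in> I" for k
    using hom[OF that] by (auto simp: hom_def)
  have C_closed: "C k \<subseteq> carrier G" if "k \<in> I" for k
    using sub[OF that] by (auto dest: subgroup.subset)
  \<comment> \<open>\<open>inv_into\<close> picks an arbitrary word with value \<open>x\<close>; the
    next fact removes the dependence on this choice.\<close>
  define \<Phi> where "\<Phi> x = word_value H (map_word f (inv_into (amalg_words I C) (word_value G) x))" for x
  have \<Phi>: "\<Phi> (word_value G w) = word_value H (map_word f w)" if "w \<in> amalg_words I C" for w
  proof -
    let ?w = "inv_into (amalg_words I C) (word_value G) (word_value G w)"
    have "?w \<in> amalg_words I C" "word_value G ?w = word_value G w"
      using that by (auto intro: inv_into_into f_inv_into_f)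
    \<comment> \<open>The injectivity clause of \<open>is_amalgam\<close> enters here: equal values
      force congruence.\<close>
    then have "amalg_cong G I C Z ?w w"
      using am that unfolding is_amalgam_def by blast
    from amalg_cong_map_word_value[OF \<open>group H\<close> sub \<open>group G\<close> hom agree this]
    show ?thesis by (simp add: \<Phi>_def)
  qed
  have letters: "snd ` set w \<subseteq> carrier G" if "w \<in> amalg_words I C" for w
    using that C_closed unfolding amalg_words_def by fastforce
  note letters_H = set_map_word_subset[where f = f and I = I and C = C, OF f_closed]
  have app: "u @ v \<in> amalg_words I C" if "u \<in> amalg_words I C" "v \<in> amalg_words I C" for u v
    using that by (simp add: amalg_words_def)
  have "\<Phi> \<in> hom G H"
  proof (rule homI)
    fix x assume "x \<in> carrier G"
    then obtain u where "u \<in> amalg_words I C" "x = word_value G u"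
      using surj by blast
    then show "\<Phi> x \<in> carrier H"
      by (simp add: \<Phi> H.word_value_closed letters_H)
  next
    fix x y assume "x \<in> carrier G" "y \<in> carrier G"
    then obtain u v where uv: "u \<in> amalg_words I C" "x = word_value G u"
      "v \<in> amalg_words I C" "y = word_value G v"
      using surj by blast
    \<comment> \<open>The word chosen for the product may differ from \<open>u @ v\<close>, but
      \<open>\<Phi>\<close> can be computed from any word with the right value.\<close>
    then have "x \<otimes>\<^bsub>G\<^esub> y = word_value G (u @ v)"
      by (simp add: G.word_value_append letters)
    with uv show "\<Phi> (x \<otimes>\<^bsub>G\<^esub> y) = \<Phi> x \<otimes>\<^bsub>H\<^esub> \<Phi> y"
      by (simp add: \<Phi> app H.word_value_append letters_H)
  qed
  moreover have "\<Phi> g = f k g" if "k \<in> I" "g \<in> C k" for k g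
  proof -
    have "g \<in> carrier G" "f k g \<in> carrier H"
      using C_closed f_closed that by blast+
    then show ?thesis
      using \<Phi>[of "[(k, g)]"] that by (simp add: amalg_words_def word_value_Cons word_value_Nil)
  qed
  ultimately show thesis by (rule that)
qed

text \<open>Uniqueness half of the universal property: the factors generate \<open>G\<close>, as
  every element is the value of a word, so induction on words suffices.\<close>

lemma amalg_hom_eqI:
  assumes "group G" and "group H" and am: "is_amalgam G I C Z"
    and \<Phi>: "\<Phi> \<in> hom G H" and \<Psi>: "\<Psi> \<in> hom G H"
    and eq: "\<And>k g. k \<in> I \<Longrightarrow> g \<in> C k \<Longrightarrow> \<Phi> g = \<Psi> g"
    and "x \<in> carrier G"
  shows "\<Phi> x = \<Psi> x"
proof -
  interpret G: group G by fact
  have C_closed: "C k \<subseteq> carrier G" if "k \<in> I" for k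
    using am that unfolding is_amalgam_def by (auto dest: subgroup.subset)
  \<comment> \<open>Membership in the carrier is carried along because \<open>hom_mult\<close> asks
    for it at each letter.\<close>
  have "word_value G w \<in> carrier G \<and> \<Phi> (word_value G w) = \<Psi> (word_value G w)"
    if "w \<in> lists (Sigma I C)" for w
    using that
  proof induction
    case Nil
    then show ?case
      using hom_one[OF \<Phi>] hom_one[OF \<Psi>] assms(1,2) by (simp add: word_value_Nil)
  next
    case (Cons a w)
    then obtain k g where "a = (k, g)" "k \<in> I" "g \<in> C k" by blast
    moreover from this have "g \<in> carrier G" using C_closed by blast
    ultimately show ?case
      using Cons.IH eq hom_mult[OF \<Phi>] hom_mult[OF \<Psi>] by (simp add: word_value_Cons)
  qed
  moreover obtain w where "w \<in> lists (Sigma I C)" "x = word_value G w"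
    using am \<open>x \<in> carrier G\<close> unfolding is_amalgam_def amalg_words_def by blast
  ultimately show ?thesis by blast
qed

section \<open>The automorphism exchanging two factors\<close>

lemma amalg_swap_iso:
  assumes "group G" and am: "is_amalgam G I C Z"
    and "i \<in> I" "j \<in> I" "i \<noteq> j"
    and \<psi>: "\<psi> \<in> iso (G\<lparr>carrier := C i\<rparr>) (G\<lparr>carrier := C j\<rparr>)"
    and fixZ: "\<And>z. z \<in> Z \<Longrightarrow> \<psi> z = z"
  shows "\<exists>\<Phi> \<in> iso G G. (\<forall>g \<in> C i. \<Phi> g = \<psi> g) \<and> (\<forall>g \<in> C j. \<Phi> g = inv_into (C i) \<psi> g) \<and>
           (\<forall>k \<in> I - {i, j}. \<forall>g \<in> C k. \<Phi> g = g)"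
proof -
  interpret G: group G by fact
  have sub: "subgroup (C k) G" "Z \<subseteq> C k" if "k \<in> I" for k
    using am that unfolding is_amalgam_def by blast+
  define \<psi>' where "\<psi>' = inv_into (C i) \<psi>"
  define f where "f k = (if k = i then \<psi> else if k = j then \<psi>' else (\<lambda>g. g))" for k
  have bij: "bij_betw \<psi> (C i) (C j)"
    using \<psi> by (simp add: iso_def)
  have "group (G\<lparr>carrier := C i\<rparr>)"
    using sub(1) \<open>i \<in> I\<close> \<open>group G\<close> by (simp add: subgroup.subgroup_is_group)
  from group.iso_set_sym[OF this \<psi>]
  have \<psi>': "\<psi>' \<in> iso (G\<lparr>carrier := C j\<rparr>) (G\<lparr>carrier := C i\<rparr>)"
    by (simp add: \<psi>'_def)
  have \<psi>_in: "\<psi> g \<in> C j" "\<psi>' (\<psi> g) = g" if "g \<in> C i" for g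
    using bij that by (auto simp: \<psi>'_def bij_betw_def)
  have \<psi>'_in: "\<psi>' g \<in> C i" "\<psi> (\<psi>' g) = g" if "g \<in> C j" for g
    using bij that by (auto simp: \<psi>'_def bij_betw_def inv_into_into f_inv_into_f)
  \<comment> \<open>The image of \<open>f k\<close> may be a factor other than \<open>C k\<close>,
    so the common target is all of \<open>G\<close>.\<close>
  have "f k \<in> hom (G\<lparr>carrier := C k\<rparr>) G" if "k \<in> I" for k
    using \<psi> \<psi>' sub(1)[OF \<open>i \<in> I\<close>] sub(1)[OF \<open>j \<in> I\<close>] sub(1)[OF that]
    by (auto simp: f_def iso_def hom_def dest: subgroup.subset)
  \<comment> \<open>For \<open>\<psi>'\<close> this follows from
    \<open>\<psi>' (\<psi> z) = z\<close> together with \<open>\<psi> z = z\<close>. Hence all the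
    \<open>f k\<close> agree on \<open>Z\<close>.\<close>
  moreover have "f k z = z" if "z \<in> Z" for k z
    using fixZ[OF that] \<psi>_in(2)[of z] sub(2)[OF \<open>i \<in> I\<close>] that by (auto simp: f_def)
  ultimately obtain \<Phi> where \<Phi>: "\<Phi> \<in> hom G G"
    and ext: "\<And>k g. k \<in> I \<Longrightarrow> g \<in> C k \<Longrightarrow> \<Phi> g = f k g"
    using amalg_hom_exists[OF \<open>group G\<close> \<open>group G\<close> am, of f] by metis
  have \<Phi>_i: "\<Phi> g = \<psi> g" if "g \<in> C i" for g
    using ext[OF \<open>i \<in> I\<close> that] by (simp add: f_def)
  have \<Phi>_j: "\<Phi> g = \<psi>' g" if "g \<in> C j" for g
    using ext[OF \<open>j \<in> I\<close> that] \<open>i \<noteq> j\<close> by (simp add: f_def)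
  have \<Phi>_other: "\<Phi> g = g" if "k \<in> I - {i, j}" "g \<in> C k" for k g
    using ext[of k g] that by (simp add: f_def)
  \<comment> \<open>The first application carries \<open>C i\<close> to \<open>C j\<close> and back
    again \<open>C j\<close> to \<open>C i\<close>, so the second one acts by the inverse
    map.\<close>
  have involution_gens: "(\<Phi> \<circ> \<Phi>) g = id g" if "k \<in> I" "g \<in> C k" for k g
    using that \<Phi>_i \<Phi>_j \<Phi>_other \<psi>_in \<psi>'_in by (cases "k = i"; cases "k = j") auto
  have id_hom: "id \<in> hom G G"
    by (simp add: hom_def)
  have "(\<Phi> \<circ> \<Phi>) x = id x" if "x \<in> carrier G" for x
    by (rule amalg_hom_eqI[OF \<open>group G\<close> \<open>group G\<close> am hom_compose[OF \<Phi> \<Phi>] id_hom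
          involution_gens that])
  \<comment> \<open>\<open>\<Phi>\<close> serves as its own inverse.\<close>
  then have "bij_betw \<Phi> (carrier G) (carrier G)"
    using \<Phi> by (intro bij_betw_byWitness[where f' = \<Phi>]) (auto simp: hom_def)
  then have "\<Phi> \<in> iso G G"
    using \<Phi> by (simp add: iso_def)
  then show ?thesis
    using \<Phi>_i \<Phi>_j \<Phi>_other unfolding \<psi>'_def by blast
qed

section \<open>The group structure on invertible matrices over \<open>A\<close>\<close>

lemma matrix_mult_entries_closed:
  fixes M N :: "'k::field^2^2"
  assumes "subring A type_ring"
    and "\<And>i j. M $ i $ j \<in> A" "\<And>i j. N $ i $ j \<in> A"
  shows "(M ** N) $ i $ j \<in> A"
proof -
  have "x + y \<in> A" "x * y \<in> A" if "x \<in> A" "y \<in> A" for x y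
    using subringE(6,7)[OF assms(1)] that by (auto simp: ring_of_type_algebra_def)
  then show ?thesis
    using assms(2,3) by (simp add: matrix_matrix_mult_def sum_2)
qed

lemma monoid_mat2_monoid:
  assumes "subring A type_ring"
  shows "monoid (mat2_monoid A)"
proof (rule monoidI)
  have "0 \<in> A" "1 \<in> A"
    using subringE(2,3)[OF assms] by (auto simp: ring_of_type_algebra_def)
  then show "\<one>\<^bsub>mat2_monoid A\<^esub> \<in> carrier (mat2_monoid A)"
    by (simp add: mat2_monoid_def mat_def)
qed (auto simp: mat2_monoid_def matrix_mul_assoc intro: matrix_mult_entries_closed[OF assms])

text \<open>An intersection of valuation rings inside \<open>K\<close>, each of them a subring, so
  closure is checked one place at a time.\<close>

lemma subring_integral_away_from: "subring (integral_away_from F Vinf) (type_ring :: 'k::field ring)"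
proof -
  interpret ring "type_ring :: 'k ring"
    by (rule ring_from_type_algebra)
  have V: "subring V type_ring" if "is_place F V" for V :: "'k set"
    using that by (simp add: is_place_def)
  show ?thesis
  proof (rule subringI)
    show "integral_away_from F Vinf \<subseteq> carrier type_ring"
      by (simp add: ring_of_type_algebra_def)
  qed (auto simp: integral_away_from_def intro: subringE(3,5,6,7)[OF V])
qed

lemma group_GL2_integral: "group (GL2 (integral_away_from F Vinf))"
  unfolding GL2_def by (intro monoid.units_group monoid_mat2_monoid subring_integral_away_from)

theorem theorem4p4:
  fixes Fq :: "'k::field set"
    and Vinf A :: "'k set"
    and \<iota> :: "'k \<Rightarrow> 'c::{field,complete_space}"
    and Fq2 :: "'e ring"
    and G :: "('k^2^2) monoid"
    and Z :: "('k^2^2) set"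
    and C :: "nat \<Rightarrow> ('k^2^2) set"
    and \<psi> :: "'k^2^2 \<Rightarrow> 'k^2^2"
    and r i j :: nat
  assumes "finite Fq" and "function_field Fq"
    and "is_place Fq Vinf" and "place_degree Fq Vinf 1"
    and "A = integral_away_from Fq Vinf"
    and "G = GL2 A" and "Z = scalars Fq"
    and "is_completion Vinf \<iota>"
    and "field Fq2" and "card (carrier Fq2) = (card Fq)\<^sup>2"
    and "r = num_quotient_vertices G \<iota> (mult_of Fq2)" and "r > 0"
    and "\<And>k. k \<le> r \<Longrightarrow> subgroup (C k) G \<and> Z \<subseteq> C k"
    and "is_amalgam G {0..r} C Z"
    and "\<And>k. 1 \<le> k \<Longrightarrow> k \<le> r \<Longrightarrow> G\<lparr>carrier := C k\<rparr> \<cong> mult_of Fq2"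
    and "1 \<le> i" and "i \<le> r" and "1 \<le> j" and "j \<le> r" and "i \<noteq> j"
    and "\<psi> \<in> iso (G\<lparr>carrier := C i\<rparr>) (G\<lparr>carrier := C j\<rparr>)"
    and "\<And>z. z \<in> Z \<Longrightarrow> \<psi> z = z"
  shows "\<exists>\<Phi> \<in> iso G G.
           (\<forall>g \<in> C i. \<Phi> g = \<psi> g) \<and>
           (\<forall>g \<in> C j. \<Phi> g = inv_into (C i) \<psi> g) \<and>
           (\<forall>k \<le> r. k \<noteq> i \<and> k \<noteq> j \<longrightarrow> (\<forall>g \<in> C k. \<Phi> g = g))"
proof -
  have "group G"
    using assms(5,6) group_GL2_integral by blast
  moreover have "i \<in> {0..r}" "j \<in> {0..r}"
    using assms(17,19) by simp_all
  \<comment> \<open>The index set starts at 0 while \<open>i\<close> and \<open>j\<close> are at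
    least 1, so \<open>C 0\<close> is among the factors fixed elementwise.\<close>
  ultimately obtain \<Phi> where "\<Phi> \<in> iso G G" "\<forall>g \<in> C i. \<Phi> g = \<psi> g"
    "\<forall>g \<in> C j. \<Phi> g = inv_into (C i) \<psi> g" "\<forall>k \<in> {0..r} - {i, j}. \<forall>g \<in> C k. \<Phi> g = g"
    using amalg_swap_iso[OF _ assms(14) _ _ assms(20-22)] by metis
  then show ?thesis
    by auto
qed

end
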